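(* Let $n,m\geq1$, $A,C\in\mathbb{R}^{n\times n}$, $B\in\mathbb{R}^{n\times m}$, and let $V_{n-1}=\mathrm{span}\{\mathrm{im}(MB): M\in\mathcal{W}_{n-1}(A,C)\}\subseteq\mathbb{R}^n$. Suppose that $0<k:=\dim V_{n-1}<n$. Then there exists an orthogonal matrix $P\in\mathbb{R}^{n\times n}$ such that $$P^\top AP=\begin{pmatrix}A_{11}&A_{12}\\0&A_{22}\end{pmatrix},\quad P^\top CP=\begin{pmatrix}C_{11}&C_{12}\\0&C_{22}\end{pmatrix},\quad P^\top B=\begin{pmatrix}B_1\\0\end{pmatrix},\quad \dim U_{n-1}=k,$$ where $A_{11},C_{11}\in\mathbb{R}^{k\times k}$, $A_{12},C_{12}\in\mathbb{R}^{k\times(n-k)}$, $A_{22},C_{22}\in\mathbb{R}^{(n-k)\times(n-k)}$, $B_1\in\mathbb{R}^{k\times m}$, and $U_{n-1}=\mathrm{span}\{\mathrm{im}(MB_1): M\in\mathcal{W}_{n-1}(A_{11},C_{11})\}$.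
   Context: For square matrices $A,C$ of the same size, $\mathcal{W}_j(A,C)$ is the set of all words of length at most $j$ over $\{A,C\}$, i.e. all products $X_1X_2\cdots X_i$ with $0\leq i\leq j$ and each factor in $\{A,C\}$ (the empty product being the identity matrix). $\mathrm{im}$ denotes the image of a matrix. *)

theory Defs
  imports "Jordan_Normal_Form.VS_Connect"
begin

text \<open>The size \<open>n\<close> is needed explicitly, for the empty word. Words have length at most \<open>j\<close>.\<close>

definition words :: "nat \<Rightarrow> nat \<Rightarrow> real mat \<Rightarrow> real mat \<Rightarrow> real mat set" where
  "words n j A C = {foldr (*) Xs (1\<^sub>m n) | Xs. set Xs \<subseteq> {A, C} \<and> length Xs \<le> j}"

definition mat_image :: "real mat \<Rightarrow> real vec set" where
  "mat_image M = {M *\<^sub>v x | x. x \<in> carrier_vec (dim_col M)}"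

definition word_span :: "nat \<Rightarrow> nat \<Rightarrow> real mat \<Rightarrow> real mat \<Rightarrow> real mat \<Rightarrow> real vec set" where
  "word_span n j A C B =
     LinearCombinations.module.span class_ring (module_vec TYPE(real) n)
       (\<Union>M \<in> words n j A C. mat_image (M * B))"

text \<open>Dimension of a linear subspace \<open>W\<close> of \<open>carrier_vec n\<close>, as a vector space in its own right.\<close>

definition subspace_dim :: "nat \<Rightarrow> real vec set \<Rightarrow> nat" where
  "subspace_dim n W = vectorspace.dim class_ring (module_vec TYPE(real) n\<lparr>carrier := W\<rparr>)"

text \<open>The library's \<^const>\<open>orthogonal_mat\<close> only asks for pairwise orthogonal nonzero
  columns, not for orthonormal ones, hence the following definition.\<close>

definition orthonormal_mat :: "real mat \<Rightarrow> bool" where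
  "orthonormal_mat P \<longleftrightarrow>
     square_mat P \<and> inverts_mat P\<^sup>T P \<and> inverts_mat P P\<^sup>T"

end

theory Submission
  imports Defs
begin

text \<open>
  Write \<open>W\<close> for the span of the images \<open>M B\<close> over the words \<open>M\<close> of length at most \<open>n - 1\<close>. The
  theorem says that \<open>W\<close> is a common invariant subspace of \<open>A\<close> and \<open>C\<close> that contains the image
  of \<open>B\<close>, expressed in an orthonormal basis of \<open>\<real>\<^sup>n\<close> whose first \<open>k\<close> vectors span \<open>W\<close>, and that
  the compressed system on \<open>W\<close> reaches all of \<open>W\<close>.

  \<^emph>\<open>Invariance.\<close> The spaces for word length at most \<open>0, 1, 2, \<dots>\<close>, preceded by the zero space, form
  an increasing chain (\<open>reach\<close>). Each member is determined by the previous one, being spanned by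
  \<open>im B\<close> and the images of the previous space under \<open>A\<close> and \<open>C\<close>. So the chain is
  constant as soon as two consecutive members agree, and, since every strict step makes room for
  one more orthonormal vector, this happens within \<open>n\<close> steps (\<open>chain_stabilises\<close>,
  \<open>reach_stabilises\<close>). Multiplication by \<open>A\<close> or \<open>C\<close> leads from one member of the chain to the next,
  hence from \<open>W\<close> into \<open>W\<close>.

  \<^emph>\<open>Block form.\<close> An orthonormal basis \<open>us\<close> of \<open>W\<close> extends to an orthonormal basis \<open>us @ vs\<close> of
  \<open>\<real>\<^sup>n\<close> (\<open>orthonormal_extend\<close>); these vectors are the columns of \<open>P\<close>. The lower left block of
  \<open>P\<^sup>T A P\<close> has the entries \<open>v \<bullet> A u\<close> with \<open>u\<close> in \<open>us\<close> and \<open>v\<close> in \<open>vs\<close>, which vanish because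
  \<open>A u\<close> lies in \<open>W\<close> and \<open>v\<close> is perpendicular to \<open>W\<close>. The same holds for \<open>C\<close>, and the
  lower block of \<open>P\<^sup>T B\<close> vanishes because the columns of \<open>B\<close> lie in \<open>W\<close>.

  \<^emph>\<open>Dimension of the compressed space.\<close> Let \<open>R\<close> be the matrix with rows \<open>us\<close>. On \<open>W\<close> it is the
  coordinate isomorphism onto \<open>\<real>\<^sup>k\<close>, with inverse \<open>R\<^sup>T\<close>. The upper left block of \<open>P\<^sup>T A P\<close> is
  \<open>A\<^sub>1\<^sub>1 = R A R\<^sup>T\<close>, so that \<open>R A w = A\<^sub>1\<^sub>1 R w\<close> for \<open>w\<close> in \<open>W\<close>, likewise for \<open>C\<close>, and
  \<open>B\<^sub>1 = R B\<close>. Therefore \<open>R\<close> carries the chain of \<open>(A, C, B)\<close> into the chain of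
  \<open>(A\<^sub>1\<^sub>1, C\<^sub>1\<^sub>1, B\<^sub>1)\<close> (\<open>reach_intertwine\<close>), and the space \<open>U\<close> of the compressed system contains
  \<open>R W = \<real>\<^sup>k\<close>.
\<close>

section \<open>Orthonormal lists and subspaces\<close>

abbreviation vec_subspace :: "nat \<Rightarrow> real vec set \<Rightarrow> bool" where
  "vec_subspace n S \<equiv> submodule class_ring S (module_vec TYPE(real) n)"

text \<open>Distinctness is demanded separately because the inner product condition sees only the set of
  vectors; it makes the length of the list the dimension of its span.\<close>

definition orthonormal :: "nat \<Rightarrow> real vec list \<Rightarrow> bool" where
  "orthonormal n us \<longleftrightarrow> distinct us \<and> set us \<subseteq> carrier_vec n \<and>
     (\<forall>u\<in>set us. \<forall>v\<in>set us. u \<bullet> v = (if u = v then 1 else 0))"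

lemma mult_mat_unit_vec:
  fixes M :: "real mat"
  assumes "M \<in> carrier_mat r c" and "j < c"
  shows "M *\<^sub>v unit_vec c j = col M j"
  using assms by (intro eq_vecI) auto

context
  fixes n :: nat
begin

interpretation vec_space "TYPE(real)" n .

lemma vec_subspaceI:
  assumes "S \<subseteq> carrier_vec n" and "0\<^sub>v n \<in> S"
    and "\<And>v w. v \<in> S \<Longrightarrow> w \<in> S \<Longrightarrow> v + w \<in> S"
    and "\<And>c v. v \<in> S \<Longrightarrow> c \<cdot>\<^sub>v v \<in> S"
  shows "vec_subspace n S"
  unfolding submodule_def using assms vec_module by (auto simp: module_vec_simps)

lemma vec_subspaceD:
  assumes "vec_subspace n S"
  shows "S \<subseteq> carrier_vec n" and "0\<^sub>v n \<in> S"
    and "v \<in> S \<Longrightarrow> w \<in> S \<Longrightarrow> v + w \<in> S"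
    and "v \<in> S \<Longrightarrow> c \<cdot>\<^sub>v v \<in> S"
  using assms unfolding submodule_def by (auto simp: module_vec_simps)

lemma vec_subspace_span: "G \<subseteq> carrier_vec n \<Longrightarrow> vec_subspace n (span G)"
  by (rule span_is_submodule)

lemma vec_subspace_preimage:
  assumes "M \<in> carrier_mat r n" and "vec_subspace r T"
  shows "vec_subspace n {v \<in> carrier_vec n. M *\<^sub>v v \<in> T}"
proof -
  have "M *\<^sub>v 0\<^sub>v n = 0\<^sub>v r" using assms(1) by (intro eq_vecI) auto
  then show ?thesis
  using assms(1) submodule.subset[OF assms(2)] submodule.m_closed[OF assms(2)]
    submodule.zero_closed[OF assms(2)] submodule.smult_closed[OF assms(2)]
  by (intro vec_subspaceI)
    (auto simp: module_vec_simps mult_add_distrib_mat_vec mult_mat_vec)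
qed

lemma orthonormal_rows_cols:
  assumes "orthonormal n us"
  shows "mat_of_rows n us * mat_of_cols n us = 1\<^sub>m (length us)"
  using assms unfolding orthonormal_def
  by (intro eq_matI) (auto simp: nth_eq_iff_index_eq subset_iff)

lemma mat_of_cols_mult_in_span:
  assumes "set us \<subseteq> carrier_vec n" and "x \<in> carrier_vec (length us)"
  shows "mat_of_cols n us *\<^sub>v x \<in> span (set us)"
proof -
  have "mat_of_cols n us *\<^sub>v x
      = lincomb (\<lambda>l. \<Sum>i\<in>{0..<length us}. if l = us ! i then x $ i else 0) (set us)"
    using assms by (intro mat_of_cols_mult_as_finsum) auto
  then show ?thesis by (rule in_spanI) auto
qed

text \<open>Taking the inner product of a vanishing linear combination with one of the vectors isolates
  the coefficient of that vector.\<close>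

lemma orthonormal_lin_indpt:
  assumes "orthonormal n us"
  shows "lin_indpt (set us)"
proof (rule finite_lin_indpt2)
  have ip: "u \<bullet> v = (if u = v then 1 else 0)" if "u \<in> set us" "v \<in> set us" for u v
    using assms that unfolding orthonormal_def by auto
  show "finite (set us)" by simp
  show car: "set us \<subseteq> carrier_vec n"
    using assms unfolding orthonormal_def by auto
  fix a assume lc: "lincomb a (set us) = 0\<^sub>v n"
  show "\<forall>u\<in>set us. a u = 0"
  proof
    fix u assume u: "u \<in> set us"
    then have uc: "u \<in> carrier_vec n" using car by auto
    have "0 = lincomb a (set us) \<bullet> u" using lc uc by simp
    also have "\<dots> = (\<Sum>v\<in>set us. (a v \<cdot>\<^sub>v v) \<bullet> u)"
      unfolding lincomb_def using car uc by (intro finsum_scalar_prod_sum) auto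
    also have "\<dots> = (\<Sum>v\<in>set us. if v = u then a v else 0)"
      using car uc u by (intro sum.cong refl) 
      (auto simp: ip subset_iff smult_scalar_prod_distrib[of _ n])
    also have "\<dots> = a u" using u by simp
    finally show "a u = 0" by simp
  qed
qed

lemma orthonormal_length_le:
  assumes "orthonormal n us"
  shows "length us \<le> n"
proof -
  have "card (set us) \<le> dim"
    using assms orthonormal_lin_indpt[OF assms]
    by (intro li_le_dim(2)) (auto simp: orthonormal_def)
  then show ?thesis
    using assms by (simp add: orthonormal_def distinct_card dim_is_n)
qed

text \<open>Subtract from \<open>v\<close> its projection to the span of \<open>us\<close> and normalise. The new vector stays
  in the subspace \<open>S\<close>, which is what makes the bases below adapted to a given subspace.\<close>

lemma gram_schmidt_step:
  assumes us: "orthonormal n us" and S: "vec_subspace n S" "set us \<subseteq> S"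
    and v: "v \<in> S" "v \<notin> span (set us)"
  shows "\<exists>w\<in>S. orthonormal n (us @ [w])"
proof -
  let ?R = "mat_of_rows n us" and ?C = "mat_of_cols n us"
  have car: "set us \<subseteq> carrier_vec n" using us by (simp add: orthonormal_def)
  have vc: "v \<in> carrier_vec n" using v(1) vec_subspaceD(1)[OF S(1)] by auto
  define p where "p = ?C *\<^sub>v (?R *\<^sub>v v)"
  have Rv: "?R *\<^sub>v v \<in> carrier_vec (length us)" by (simp add: carrier_vecI)
  have p: "p \<in> span (set us)"
    unfolding p_def using car Rv by (rule mat_of_cols_mult_in_span)
  have pS: "p \<in> S" using p span_is_subset[OF S(2,1)] by auto
  have pc: "p \<in> carrier_vec n" using pS vec_subspaceD(1)[OF S(1)] by auto
  define w where "w = v + (-1) \<cdot>\<^sub>v p"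
  have wS: "w \<in> S" unfolding w_def using v(1) pS by (intro vec_subspaceD[OF S(1)])
  have wc: "w \<in> carrier_vec n" using wS vec_subspaceD(1)[OF S(1)] by auto
  have "?R *\<^sub>v p = (?R * ?C) *\<^sub>v (?R *\<^sub>v v)"
    unfolding p_def using Rv by (intro assoc_mult_mat_vec[symmetric]) auto
  also have "\<dots> = ?R *\<^sub>v v" using Rv by (simp add: orthonormal_rows_cols[OF us])
  finally have Rp: "?R *\<^sub>v p = ?R *\<^sub>v v" .
  have perp: "u \<bullet> w = 0" if "u \<in> set us" for u
  proof -
    from that obtain i where i: "i < length us" "u = us ! i" by (auto simp: in_set_conv_nth)
    have uc: "u \<in> carrier_vec n" using that car by auto
    have "u \<bullet> p = (?R *\<^sub>v p) $ i" "u \<bullet> v = (?R *\<^sub>v v) $ i"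
      using i uc by (auto simp: mat_of_rows_row)
    then have "u \<bullet> p = u \<bullet> v" using Rp by simp
    then show ?thesis
      unfolding w_def using uc vc pc by (simp add: scalar_prod_add_distrib[of _ n])
  qed
  have "w \<noteq> 0\<^sub>v n"
  proof
    assume w0: "w = 0\<^sub>v n"
    have "v = p"
    proof (rule eq_vecI)
      fix i assume "i < dim_vec p"
      then show "v $ i = p $ i"
        using arg_cong[OF w0, of "\<lambda>x. x $ i"] vc pc by (auto simp: w_def)
    qed (use vc pc in auto)
    then show False using p v(2) by simp
  qed
  then have pos: "w \<bullet> w > 0"
    using wc by (metis vec_conjugate_real conjugate_square_greater_0_vec)
  define e where "e = (1 / sqrt (w \<bullet> w)) \<cdot>\<^sub>v w"
  have ec: "e \<in> carrier_vec n" using wc by (simp add: e_def)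
  have ee: "e \<bullet> e = 1"
    unfolding e_def using wc pos by (simp add: field_simps)
  have ue: "u \<bullet> e = 0" if "u \<in> set us" for u
    using perp[OF that] that car wc by (auto simp: e_def)
  have eu: "e \<bullet> u = 0" if "u \<in> set us" for u
    using ue[OF that] comm_scalar_prod[of e n u] ec that car by auto
  have "e \<notin> set us" using ue[of e] ee by auto
  then have "orthonormal n (us @ [e])"
    using us ec ee ue eu unfolding orthonormal_def by auto
  moreover have "e \<in> S" unfolding e_def by (rule vec_subspaceD(4)[OF S(1) wS])
  ultimately show ?thesis by blast
qed

text \<open>The Gram-Schmidt step is repeated until \<open>S\<close> is exhausted; it ends because an orthonormal list
  has at most \<open>n\<close> members. With \<open>us = []\<close> this gives an orthonormal basis of \<open>S\<close>.\<close>

lemma orthonormal_extend: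
  assumes "orthonormal n us" and "vec_subspace n S" and "set us \<subseteq> S"
  shows "\<exists>vs. orthonormal n (us @ vs) \<and> span (set (us @ vs)) = S"
  using assms
proof (induction "n - length us" arbitrary: us rule: less_induct)
  case less
  have sub: "span (set us) \<subseteq> S" using less.prems by (intro span_is_subset)
  show ?case
  proof (cases "span (set us) = S")
    case True
    then show ?thesis using less.prems by (intro exI[of _ "[]"]) simp
  next
    case False
    then obtain v where "v \<in> S" "v \<notin> span (set us)" using sub by auto
    then obtain w where w: "w \<in> S" "orthonormal n (us @ [w])"
      using gram_schmidt_step[OF less.prems] by blast
    have "n - length (us @ [w]) < n - length us"
      using orthonormal_length_le[OF w(2)] by simp
    from less.hyps[OF this w(2) less.prems(2)] w(1) less.prems(3)
    obtain vs where "orthonormal n ((us @ [w]) @ vs)" "span (set ((us @ [w]) @ vs)) = S"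
      by auto
    then show ?thesis by (intro exI[of _ "w # vs"]) simp
  qed
qed

text \<open>For orthonormal \<open>us\<close> the matrix with columns \<open>us\<close> times its transpose is the orthogonal
  projection to their span. Its fixed points form a subspace, so it suffices that it fixes
  each member of \<open>us\<close>.\<close>

lemma orthonormal_expansion:
  assumes us: "orthonormal n us" and v: "v \<in> span (set us)"
  shows "mat_of_cols n us *\<^sub>v (mat_of_rows n us *\<^sub>v v) = v"
proof -
  define M where "M = mat_of_cols n us * mat_of_rows n us"
  have Mc: "M \<in> carrier_mat n n"
    unfolding M_def by (rule mult_carrier_mat[OF mat_of_cols_carrier(1) mat_of_rows_carrier(1)])
  have car: "set us \<subseteq> carrier_vec n" using us by (simp add: orthonormal_def)
  have M: "M *\<^sub>v x = mat_of_cols n us *\<^sub>v (mat_of_rows n us *\<^sub>v x)" if "x \<in> carrier_vec n" for x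
    unfolding M_def using that by (intro assoc_mult_mat_vec) auto
  have "vec_subspace n {x \<in> carrier_vec n. M *\<^sub>v x = x}"
  proof (rule vec_subspaceI)
    have "M *\<^sub>v 0\<^sub>v n = 0\<^sub>v n" using Mc by (intro eq_vecI) auto
    then show "0\<^sub>v n \<in> {x \<in> carrier_vec n. M *\<^sub>v x = x}" by simp
  qed (use Mc in \<open>auto simp: mult_add_distrib_mat_vec mult_mat_vec\<close>)
  moreover have "set us \<subseteq> {x \<in> carrier_vec n. M *\<^sub>v x = x}"
  proof
    fix u assume u: "u \<in> set us"
    then obtain i where i: "i < length us" "u = us ! i" by (auto simp: in_set_conv_nth)
    have uc: "u \<in> carrier_vec n" using u car by auto
    have "mat_of_rows n us *\<^sub>v u = col (mat_of_rows n us * mat_of_cols n us) i"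
      using i uc by (subst col_mult2[of _ "length us" n _ "length us"]) auto
    also have "\<dots> = unit_vec (length us) i" using i by (simp add: orthonormal_rows_cols[OF us])
    finally have "M *\<^sub>v u = mat_of_cols n us *\<^sub>v unit_vec (length us) i" using M uc by simp
    also have "\<dots> = u"
      using i uc by (subst mult_mat_unit_vec[of _ n "length us"]) auto
    finally show "u \<in> {x \<in> carrier_vec n. M *\<^sub>v x = x}" using uc by simp
  qed
  ultimately have "span (set us) \<subseteq> {x \<in> carrier_vec n. M *\<^sub>v x = x}"
    by (intro span_is_subset)
  then show ?thesis using v M by auto
qed

lemma orthonormal_append_perp:
  fixes us vs :: "real vec list"
  assumes ws: "orthonormal n (us @ vs)" and v: "v \<in> set vs" and w: "w \<in> span (set us)"
  shows "v \<bullet> w = 0"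
proof -
  have car: "set us \<subseteq> carrier_vec n" using ws by (simp add: orthonormal_def)
  have "v \<in> orthogonal_complement (set us)"
    using ws v by (auto simp: orthonormal_def orthogonal_complement_def)
  then have "v \<in> orthogonal_complement (span (set us))" using car by simp
  then show ?thesis using w by (simp add: orthogonal_complement_def)
qed

lemma subspace_dim_orthonormal:
  assumes us: "orthonormal n us"
  shows "subspace_dim n (span (set us)) = length us"
proof -
  let ?S = "span (set us)"
  have car: "set us \<subseteq> carrier_vec n" using us by (simp add: orthonormal_def)
  have S: "vec_subspace n ?S" by (rule vec_subspace_span[OF car])
  have uS: "set us \<subseteq> ?S" by (rule in_own_span[OF car])
  interpret S: vectorspace class_ring "module_vec TYPE(real) n\<lparr>carrier := ?S\<rparr>"
    using S by (intro subspace_is_vs) (simp add: subspace_def vectorspace_axioms)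
  have "S.basis (set us)"
    unfolding S.basis_def using uS orthonormal_lin_indpt[OF us]
    by (simp add: span_li_not_depend[OF uS S])
  then have "S.dim = card (set us)" by (intro S.dim_basis) auto
  then show ?thesis using us by (simp add: subspace_dim_def orthonormal_def distinct_card)
qed

lemma subspace_dim_carrier: "subspace_dim n (carrier_vec n) = n"
proof -
  have "module_vec TYPE(real) n\<lparr>carrier := carrier_vec n\<rparr> = module_vec TYPE(real) n"
    by (simp add: module_vec_def)
  then show ?thesis unfolding subspace_dim_def using dim_is_n by metis
qed

text \<open>If the chain still grew after \<open>n\<close> steps, then by \<open>stays\<close> all its earlier steps would be strict
  as well. Each strict step allows one further Gram-Schmidt vector, so the member with index
  \<open>n + 1\<close> would contain \<open>n + 1\<close> orthonormal vectors.\<close>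

lemma chain_stabilises:
  assumes sub: "\<And>j. vec_subspace n (S j)" and mono: "\<And>j. S j \<subseteq> S (Suc j)"
    and stays: "\<And>j. S (Suc j) \<subseteq> S j \<Longrightarrow> S (Suc (Suc j)) \<subseteq> S (Suc j)"
  shows "S (Suc n) \<subseteq> S n"
proof (rule ccontr)
  assume new: "\<not> S (Suc n) \<subseteq> S n"
  have strict: "\<not> S (Suc j) \<subseteq> S j" if "j \<le> n" for j
    using that
  proof (induction j rule: inc_induct)
    case base
    show ?case by (rule new)
  next
    case (step j)
    then show ?case using stays by blast
  qed
  have "\<exists>us. orthonormal n us \<and> set us \<subseteq> S j \<and> j \<le> length us" if "j \<le> Suc n" for j
    using that
  proof (induction j)
    case 0
    show ?case by (rule exI[of _ "[]"]) (simp add: orthonormal_def)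
  next
    case (Suc j)
    then obtain us where us: "orthonormal n us" "set us \<subseteq> S j" "j \<le> length us" by auto
    have "span (set us) \<subseteq> S j" using us(2) sub by (rule span_is_subset)
    then obtain v where v: "v \<in> S (Suc j)" "v \<notin> span (set us)"
      using strict[of j] Suc.prems by auto
    obtain w where "w \<in> S (Suc j)" "orthonormal n (us @ [w])"
      using gram_schmidt_step[OF us(1) sub[of "Suc j"] _ v] us(2) mono by blast
    then show ?case using us mono by (intro exI[of _ "us @ [w]"]) auto
  qed
  from this[of "Suc n"] obtain us where "orthonormal n us" "Suc n \<le> length us" by auto
  then show False using orthonormal_length_le by fastforce
qed

end

section \<open>The chain of word spans\<close>

text \<open>The index is shifted by one: \<open>reach n A C B j\<close> belongs to words of length less than \<open>j\<close>. The
  zero space at the start saves a case distinction on \<open>B = 0\<close>, and the space of the theorem is the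
  member with index \<open>n\<close>.\<close>

primrec reach :: "nat \<Rightarrow> real mat \<Rightarrow> real mat \<Rightarrow> real mat \<Rightarrow> nat \<Rightarrow> real vec set" where
  "reach n A C B 0 = {0\<^sub>v n}"
| "reach n A C B (Suc j) = word_span n j A C B"

lemma words_carrier:
  assumes "A \<in> carrier_mat n n" and "C \<in> carrier_mat n n" and "M \<in> words n j A C"
  shows "M \<in> carrier_mat n n"
proof -
  have "foldr (*) Xs (1\<^sub>m n) \<in> carrier_mat n n" if "set Xs \<subseteq> {A, C}" for Xs
    using that assms(1,2) by (induction Xs) auto
  then show ?thesis using assms(3) by (auto simp: words_def)
qed

lemma words_0: "words n 0 A C = {1\<^sub>m n}"
  by (auto simp: words_def)

lemma words_SucE:
  assumes "M \<in> words n (Suc j) A C"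
  obtains "M = 1\<^sub>m n" | X N where "X \<in> {A, C}" and "N \<in> words n j A C" and "M = X * N"
proof -
  obtain Xs where Xs: "M = foldr (*) Xs (1\<^sub>m n)" "set Xs \<subseteq> {A, C}" "length Xs \<le> Suc j"
    using assms by (auto simp: words_def)
  show thesis
  proof (cases Xs)
    case Nil
    then show ?thesis using Xs that(1) by simp
  next
    case (Cons X Ys)
    then show ?thesis using Xs by (intro that(2)[of X "foldr (*) Ys (1\<^sub>m n)"]) (auto simp: words_def)
  qed
qed

lemma words_Cons:
  assumes "X \<in> {A, C}" and "N \<in> words n j A C"
  shows "X * N \<in> words n (Suc j) A C"
proof -
  obtain Xs where "N = foldr (*) Xs (1\<^sub>m n)" "set Xs \<subseteq> {A, C}" "length Xs \<le> j"
    using assms(2) by (auto simp: words_def)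
  then show ?thesis using assms(1) by (auto simp: words_def intro!: exI[of _ "X # Xs"])
qed

context
  fixes n m :: nat and A B C :: "real mat"
  assumes A: "A \<in> carrier_mat n n" and C: "C \<in> carrier_mat n n" and B: "B \<in> carrier_mat n m"
begin

interpretation vec_space "TYPE(real)" n .

abbreviation word_gens :: "nat \<Rightarrow> real vec set" where
  "word_gens j \<equiv> \<Union>M \<in> words n j A C. mat_image (M * B)"

lemma word_gens_carrier: "word_gens j \<subseteq> carrier_vec n"
  using words_carrier[OF A C] B by (fastforce simp: mat_image_def)

lemma word_gens_subset_reach: "word_gens j \<subseteq> reach n A C B (Suc j)"
  using in_own_span[OF word_gens_carrier] by (simp add: word_span_def)

lemma vec_subspace_reach: "vec_subspace n (reach n A C B j)"
proof (cases j)
  case 0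
  then show ?thesis by (auto intro: vec_subspaceI)
next
  case (Suc i)
  then show ?thesis using vec_subspace_span[OF word_gens_carrier] by (simp add: word_span_def)
qed

lemma reach_mono_Suc: "reach n A C B j \<subseteq> reach n A C B (Suc j)"
proof (cases j)
  case 0
  then show ?thesis using vec_subspaceD(2)[OF vec_subspace_reach, of "Suc j"] by simp
next
  case (Suc i)
  have "word_gens i \<subseteq> word_gens (Suc i)" by (fastforce simp: words_def)
  then show ?thesis using Suc by (simp add: word_span_def span_is_monotone)
qed

lemma image_subset_reach: "mat_image B \<subseteq> reach n A C B (Suc j)"
proof -
  have "1\<^sub>m n \<in> words n j A C" by (auto simp: words_def intro!: exI[of _ "[]"])
  then show ?thesis using word_gens_subset_reach[of j] B by force
qed

text \<open>Prepending a letter to a word maps generators to generators; as the preimage of a subspace is a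
  subspace, this passes to the spans.\<close>

lemma mult_reach_subset:
  assumes X: "X \<in> {A, C}" and v: "v \<in> reach n A C B j"
  shows "X *\<^sub>v v \<in> reach n A C B (Suc j)"
proof -
  have Xc: "X \<in> carrier_mat n n" using X A C by auto
  let ?T = "{v \<in> carrier_vec n. X *\<^sub>v v \<in> reach n A C B (Suc j)}"
  have T: "vec_subspace n ?T" by (rule vec_subspace_preimage[OF Xc vec_subspace_reach])
  have "reach n A C B j \<subseteq> ?T"
  proof (cases j)
    case 0
    then show ?thesis using vec_subspaceD(2)[OF T] by simp
  next
    case (Suc i)
    have "word_gens i \<subseteq> ?T"
    proof
      fix g assume g: "g \<in> word_gens i"
      then obtain M x where M: "M \<in> words n i A C" and x: "x \<in> carrier_vec m"
        and gM: "g = M * B *\<^sub>v x"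
        using B by (auto simp: mat_image_def)
      have Mc: "M \<in> carrier_mat n n" by (rule words_carrier[OF A C M])
      have "X *\<^sub>v g = X * M * B *\<^sub>v x"
        unfolding gM using Xc Mc B x
        by (simp add: assoc_mult_mat_vec[of _ n n _ m] assoc_mult_mat_vec[of _ n n _ n])
      then have "X *\<^sub>v g \<in> word_gens (Suc i)"
        using words_Cons[OF X M] B x by (auto simp: mat_image_def)
      then show "g \<in> ?T"
        using g word_gens_carrier word_gens_subset_reach[of "Suc i"] Suc by auto
    qed
    then show ?thesis
      using span_is_subset[OF _ T] Suc by (simp add: word_span_def)
  qed
  then show ?thesis using v by auto
qed

text \<open>Together with \<open>image_subset_reach\<close> and \<open>mult_reach_subset\<close> this characterises each member of the
  chain by the previous one, so that words need not be mentioned any more: a nonempty word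
  is a letter times a shorter word, and the empty word contributes the image of \<open>B\<close>.\<close>

lemma reach_Suc_least:
  assumes T: "vec_subspace n T" and BT: "mat_image B \<subseteq> T"
    and step: "\<And>X v. X \<in> {A, C} \<Longrightarrow> v \<in> reach n A C B j \<Longrightarrow> X *\<^sub>v v \<in> T"
  shows "reach n A C B (Suc j) \<subseteq> T"
proof -
  have "mat_image (M * B) \<subseteq> T" if M: "M \<in> words n j A C" for M
  proof (cases j)
    case 0
    then show ?thesis using M BT B by (simp add: words_0)
  next
    case (Suc i)
    from M[unfolded Suc] show ?thesis
    proof (cases rule: words_SucE)
      case 1
      then show ?thesis using BT B by simp
    next
      case (2 X N)
      show ?thesis
      proof
        fix g assume "g \<in> mat_image (M * B)"
        then obtain x where x: "x \<in> carrier_vec m" and g: "g = M * B *\<^sub>v x"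
          using B by (auto simp: mat_image_def)
        have Xc: "X \<in> carrier_mat n n" using 2 A C by auto
        have Nc: "N \<in> carrier_mat n n" by (rule words_carrier[OF A C 2(2)])
        have "N * B *\<^sub>v x \<in> word_gens i" using 2 B x by (auto simp: mat_image_def)
        then have "X *\<^sub>v (N * B *\<^sub>v x) \<in> T"
          using step[OF 2(1)] word_gens_subset_reach[of i] Suc by auto
        also have "X *\<^sub>v (N * B *\<^sub>v x) = g"
          unfolding g 2(3) using Xc Nc B x
          by (simp add: assoc_mult_mat_vec[of _ n n _ m] assoc_mult_mat_vec[of _ n n _ n])
        finally show "g \<in> T" .
      qed
    qed
  qed
  then show ?thesis using span_is_subset[OF _ T] by (simp add: word_span_def UN_subset_iff)
qed

lemma reach_stabilises: "reach n A C B (Suc n) = reach n A C B n"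
proof (rule antisym)
  show "reach n A C B (Suc n) \<subseteq> reach n A C B n"
  proof (rule chain_stabilises)
    fix j assume stat: "reach n A C B (Suc j) \<subseteq> reach n A C B j"
    show "reach n A C B (Suc (Suc j)) \<subseteq> reach n A C B (Suc j)"
    proof (rule reach_Suc_least[OF vec_subspace_reach image_subset_reach])
      fix X v assume "X \<in> {A, C}" "v \<in> reach n A C B (Suc j)"
      then show "X *\<^sub>v v \<in> reach n A C B (Suc j)" using stat by (intro mult_reach_subset) auto
    qed
  qed (rule vec_subspace_reach reach_mono_Suc)+
qed (rule reach_mono_Suc)

end

section \<open>Compression and block matrices\<close>

text \<open>The preimages under \<open>R\<close> of the spaces of the compressed system are subspaces which satisfy the
  recursion of the original chain as inclusions; minimality of that chain gives the claim. The
  intertwining relations are assumed on the reachable vectors, which is where a compression to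
  an invariant subspace provides them.\<close>

lemma reach_intertwine:
  assumes A: "A \<in> carrier_mat n n" and C: "C \<in> carrier_mat n n" and B: "B \<in> carrier_mat n m"
    and A': "A' \<in> carrier_mat k k" and C': "C' \<in> carrier_mat k k" and R: "R \<in> carrier_mat k n"
    and RA: "\<And>j v. v \<in> reach n A C B j \<Longrightarrow> R *\<^sub>v (A *\<^sub>v v) = A' *\<^sub>v (R *\<^sub>v v)"
    and RC: "\<And>j v. v \<in> reach n A C B j \<Longrightarrow> R *\<^sub>v (C *\<^sub>v v) = C' *\<^sub>v (R *\<^sub>v v)"
    and v: "v \<in> reach n A C B j"
  shows "R *\<^sub>v v \<in> reach k A' C' (R * B) j"
proof -
  have B': "R * B \<in> carrier_mat k m" using R B by simp
  let ?T = "\<lambda>j. {v \<in> carrier_vec n. R *\<^sub>v v \<in> reach k A' C' (R * B) j}"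
  have T: "vec_subspace n (?T j)" for j
    by (rule vec_subspace_preimage[OF R vec_subspace_reach[OF A' C' B']])
  have "reach n A C B j \<subseteq> ?T j"
  proof (induction j)
    case 0
    show ?case using vec_subspaceD(2)[OF T[of 0]] by simp
  next
    case (Suc j)
    show ?case
    proof (rule reach_Suc_least[OF A C B T])
      show "mat_image B \<subseteq> ?T (Suc j)"
      proof
        fix g assume "g \<in> mat_image B"
        then obtain x where x: "x \<in> carrier_vec m" and g: "g = B *\<^sub>v x"
          using B by (auto simp: mat_image_def)
        have "R *\<^sub>v g = R * B *\<^sub>v x"
          unfolding g using R B x by (intro assoc_mult_mat_vec[symmetric])
        then have "R *\<^sub>v g \<in> mat_image (R * B)" using x B by (auto simp: mat_image_def)
        then show "g \<in> ?T (Suc j)"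
          using image_subset_reach[OF A' C' B'] g B x by auto
      qed
    next
      fix X v assume X: "X \<in> {A, C}" and v: "v \<in> reach n A C B j"
      obtain X' where X': "X' \<in> {A', C'}" "R *\<^sub>v (X *\<^sub>v v) = X' *\<^sub>v (R *\<^sub>v v)"
        using X RA[OF v] RC[OF v] by auto
      have "R *\<^sub>v v \<in> reach k A' C' (R * B) j" using Suc.IH v by auto
      then have "R *\<^sub>v (X *\<^sub>v v) \<in> reach k A' C' (R * B) (Suc j)"
        using mult_reach_subset[OF A' C' B' X'(1)] X'(2) by simp
      moreover have "X *\<^sub>v v \<in> carrier_vec n"
        using mult_reach_subset[OF A C B X v] vec_subspaceD(1)[OF vec_subspace_reach[OF A C B]]
        by blast
      ultimately show "X *\<^sub>v v \<in> ?T (Suc j)" by simp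
    qed
  qed
  then show ?thesis using v by auto
qed

lemma rows_mult_cols_index:
  assumes "set us \<subseteq> carrier_vec n" and "set vs \<subseteq> carrier_vec n" and "X \<in> carrier_mat n n"
    and "i < length us" and "j < length vs"
  shows "(mat_of_rows n us * X * mat_of_cols n vs) $$ (i, j) = us ! i \<bullet> (X *\<^sub>v (vs ! j))"
proof -
  have car: "us ! i \<in> carrier_vec n" "vs ! j \<in> carrier_vec n" using assms by auto
  have "mat_of_rows n us * X * mat_of_cols n vs = mat_of_rows n us * (X * mat_of_cols n vs)"
    using assms by (intro assoc_mult_mat) auto
  also have "\<dots> $$ (i, j) = row (mat_of_rows n us) i \<bullet> col (X * mat_of_cols n vs) j"
    using assms by simp
  also have "\<dots> = us ! i \<bullet> (X *\<^sub>v (vs ! j))"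
    using assms car by (subst col_mult2[of _ n n _ "length vs"]) auto
  finally show ?thesis .
qed

lemma conjugate_four_block:
  assumes "set us \<subseteq> carrier_vec n" and "set vs \<subseteq> carrier_vec n" and "X \<in> carrier_mat n n"
  shows "mat_of_rows n (us @ vs) * X * mat_of_cols n (us @ vs) =
    four_block_mat (mat_of_rows n us * X * mat_of_cols n us) (mat_of_rows n us * X * mat_of_cols n vs)
      (mat_of_rows n vs * X * mat_of_cols n us) (mat_of_rows n vs * X * mat_of_cols n vs)"
proof (rule eq_matI)
  have ws: "set (us @ vs) \<subseteq> carrier_vec n" using assms by simp
  fix i j assume "i < dim_row (four_block_mat
      (mat_of_rows n us * X * mat_of_cols n us) (mat_of_rows n us * X * mat_of_cols n vs)
      (mat_of_rows n vs * X * mat_of_cols n us) (mat_of_rows n vs * X * mat_of_cols n vs))"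
    and "j < dim_col (four_block_mat
      (mat_of_rows n us * X * mat_of_cols n us) (mat_of_rows n us * X * mat_of_cols n vs)
      (mat_of_rows n vs * X * mat_of_cols n us) (mat_of_rows n vs * X * mat_of_cols n vs))"
  then have "i < length us + length vs" "j < length us + length vs" by auto
  then show "(mat_of_rows n (us @ vs) * X * mat_of_cols n (us @ vs)) $$ (i, j) = four_block_mat
      (mat_of_rows n us * X * mat_of_cols n us) (mat_of_rows n us * X * mat_of_cols n vs)
      (mat_of_rows n vs * X * mat_of_cols n us) (mat_of_rows n vs * X * mat_of_cols n vs) $$ (i, j)"
    by (simp add: rows_mult_cols_index[OF ws ws assms(3)] rows_mult_cols_index[OF assms(1,1,3)]
        rows_mult_cols_index[OF assms(1,2,3)] rows_mult_cols_index[OF assms(2,1,3)]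
        rows_mult_cols_index[OF assms(2,2,3)] nth_append del: index_mult_mat(1))
qed auto

lemma mat_of_rows_append_mult:
  assumes "set us \<subseteq> carrier_vec n" and "set vs \<subseteq> carrier_vec n" and "Y \<in> carrier_mat n m"
  shows "mat_of_rows n (us @ vs) * Y = (mat_of_rows n us * Y) @\<^sub>r (mat_of_rows n vs * Y)"
  using assms
  by (intro eq_matI) (auto simp: append_rows_def nth_append subset_iff)

section \<open>The block triangular form\<close>

theorem theorem3p9:
  fixes n m k :: nat and A B C :: "real mat"
  assumes "n \<ge> 1" and "m \<ge> 1"
    and "A \<in> carrier_mat n n" and "C \<in> carrier_mat n n" and "B \<in> carrier_mat n m"
    and "k = subspace_dim n (word_span n (n - 1) A C B)"
    and "0 < k" and "k < n"
  shows "\<exists>P \<in> carrier_mat n n. orthonormal_mat P \<and>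
    (\<exists>A11 \<in> carrier_mat k k. \<exists>A12 \<in> carrier_mat k (n - k). \<exists>A22 \<in> carrier_mat (n - k) (n - k).
     \<exists>C11 \<in> carrier_mat k k. \<exists>C12 \<in> carrier_mat k (n - k). \<exists>C22 \<in> carrier_mat (n - k) (n - k).
     \<exists>B1 \<in> carrier_mat k m.
       P\<^sup>T * A * P = four_block_mat A11 A12 (0\<^sub>m (n - k) k) A22 \<and>
       P\<^sup>T * C * P = four_block_mat C11 C12 (0\<^sub>m (n - k) k) C22 \<and>
       P\<^sup>T * B = B1 @\<^sub>r 0\<^sub>m (n - k) m \<and>
       subspace_dim k (word_span k (n - 1) A11 C11 B1) = k)"
proof -
  interpret vec_space "TYPE(real)" n .
  note A = assms(3) and C = assms(4) and B = assms(5)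
  define W where "W = reach n A C B n"
  have word_span_eq: "word_span n' (n - 1) A' C' B' = reach n' A' C' B' n" for n' A' C' B'
    using assms(1) by (cases n) auto
  have W: "vec_subspace n W" unfolding W_def by (rule vec_subspace_reach[OF A C B])
  have W_inv: "X *\<^sub>v v \<in> W" if "X \<in> {A, C}" "v \<in> W" for X v
    using mult_reach_subset[OF A C B that(1)] that(2) reach_stabilises[OF A C B]
    unfolding W_def by blast
  have BW: "mat_image B \<subseteq> W"
    using image_subset_reach[OF A C B] reach_stabilises[OF A C B] unfolding W_def by blast
  have reach_W: "reach n A C B j \<subseteq> W" for j
  proof (induction j)
    case 0
    show ?case using vec_subspaceD(2)[OF W] by simp
  next
    case (Suc j)
    show ?case by (rule reach_Suc_least[OF A C B W BW]) (use W_inv Suc in blast)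
  qed

  obtain us where us: "orthonormal n us" and us_span: "span (set us) = W"
    using orthonormal_extend[of n "[]", OF _ W] vec_subspaceD(2)[OF W]
    by (auto simp: orthonormal_def)
  have uc: "set us \<subseteq> carrier_vec n" using us by (simp add: orthonormal_def)
  have "vec_subspace n (carrier_vec n)" by (rule vec_subspaceI) auto
  from orthonormal_extend[OF us this uc] obtain vs
    where ws: "orthonormal n (us @ vs)" and ws_span: "span (set (us @ vs)) = carrier_vec n"
    by blast
  have len_us: "length us = k"
    using subspace_dim_orthonormal[OF us] assms(6) by (simp only: us_span word_span_eq W_def)
  have "length (us @ vs) = n"
    using subspace_dim_orthonormal[OF ws] by (simp only: ws_span subspace_dim_carrier)
  then have len_vs: "length vs = n - k" using len_us by simp
  have vc: "set vs \<subseteq> carrier_vec n"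
    using ws by (auto simp: orthonormal_def)
  have us_W: "set us \<subseteq> W" using in_own_span[OF uc] us_span by simp
  have perp: "v \<bullet> w = 0" if "v \<in> set vs" "w \<in> W" for v w
    using orthonormal_append_perp[OF ws that(1)] that(2) us_span by simp

  define P where "P = mat_of_cols n (us @ vs)"
  have P: "P \<in> carrier_mat n n"
    unfolding P_def using mat_of_cols_carrier(1)[of n "us @ vs"] \<open>length (us @ vs) = n\<close> by simp
  have PT: "P\<^sup>T = mat_of_rows n (us @ vs)" by (simp add: P_def transpose_mat_of_cols)
  have PTP: "P\<^sup>T * P = 1\<^sub>m n"
    unfolding PT unfolding P_def using orthonormal_rows_cols[OF ws] \<open>length (us @ vs) = n\<close> by simp
  have "P\<^sup>T \<in> carrier_mat n n" using P by simp
  from mat_mult_left_right_inverse[OF this P PTP] have "P * P\<^sup>T = 1\<^sub>m n" .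
  with PTP have P_orth: "orthonormal_mat P"
    using P by (simp add: orthonormal_mat_def inverts_mat_def)

  define R where "R = mat_of_rows n us"
  define Q where "Q = mat_of_rows n vs"
  define Cu where "Cu = mat_of_cols n us"
  define Cv where "Cv = mat_of_cols n vs"
  have carr: "R \<in> carrier_mat k n" "Q \<in> carrier_mat (n - k) n" "Cu \<in> carrier_mat n k"
    "Cv \<in> carrier_mat n (n - k)"
    using len_us len_vs unfolding R_def Q_def Cu_def Cv_def by auto

  have block: "P\<^sup>T * X * P = four_block_mat (R * X * Cu) (R * X * Cv) (0\<^sub>m (n - k) k) (Q * X * Cv)"
    if X: "X \<in> {A, C}" for X
  proof -
    have Xc: "X \<in> carrier_mat n n" using X A C by auto
    have "Q * X * Cu = 0\<^sub>m (n - k) k"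
    proof (rule eq_matI)
      fix i j assume "i < dim_row (0\<^sub>m (n - k) k)" "j < dim_col (0\<^sub>m (n - k) k)"
      then have ij: "i < length vs" "j < length us" using len_us len_vs by auto
      have "us ! j \<in> W" using nth_mem[OF ij(2)] us_W by (rule rev_subsetD)
      then have "X *\<^sub>v (us ! j) \<in> W" by (rule W_inv[OF X])
      with nth_mem[OF ij(1)] have "vs ! i \<bullet> (X *\<^sub>v (us ! j)) = 0" by (rule perp)
      then have "(Q * X * Cu) $$ (i, j) = 0"
        unfolding Q_def Cu_def rows_mult_cols_index[OF vc uc Xc ij] .
      then show "(Q * X * Cu) $$ (i, j) = 0\<^sub>m (n - k) k $$ (i, j)"
        using ij len_us len_vs by simp
    qed (use carr in auto)
    then show ?thesis
      unfolding PT using conjugate_four_block[OF uc vc Xc]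
      by (simp add: P_def R_def Q_def Cu_def Cv_def)
  qed

  have "Q * B = 0\<^sub>m (n - k) m"
  proof (rule eq_matI)
    fix i j assume ij: "i < dim_row (0\<^sub>m (n - k) m)" "j < dim_col (0\<^sub>m (n - k) m)"
    have "col B j = B *\<^sub>v unit_vec m j"
      using ij B by (simp add: mult_mat_unit_vec)
    then have "col B j \<in> mat_image B" using B unit_vec_carrier by (auto simp: mat_image_def)
    then have "col B j \<in> W" using BW by blast
    moreover have vs_i: "vs ! i \<in> set vs" using ij len_vs by simp
    ultimately have "vs ! i \<bullet> col B j = 0" by (intro perp)
    moreover have "vs ! i \<in> carrier_vec n" using vs_i vc by blast
    ultimately show "(Q * B) $$ (i, j) = 0\<^sub>m (n - k) m $$ (i, j)"
      using ij B len_vs by (simp add: Q_def)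
  qed (use carr B in auto)
  then have B_block: "P\<^sup>T * B = (R * B) @\<^sub>r 0\<^sub>m (n - k) m"
    unfolding PT using mat_of_rows_append_mult[OF uc vc B] by (simp add: R_def Q_def)

  \<comment> \<open>\<open>Cu R\<close> is the identity on \<open>W\<close>, so it may be inserted behind \<open>X\<close>.\<close>
  have inter: "R *\<^sub>v (X *\<^sub>v v) = R * X * Cu *\<^sub>v (R *\<^sub>v v)"
    if X: "X \<in> {A, C}" and v: "v \<in> W" for X v
  proof -
    have Xc: "X \<in> carrier_mat n n" using X A C by auto
    have vcar: "v \<in> carrier_vec n" using v vec_subspaceD(1)[OF W] by auto
    have "R * X * Cu *\<^sub>v (R *\<^sub>v v) = R * X *\<^sub>v (Cu *\<^sub>v (R *\<^sub>v v))"
      using carr Xc vcar by (intro assoc_mult_mat_vec) auto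
    also have "Cu *\<^sub>v (R *\<^sub>v v) = v"
      unfolding Cu_def R_def using orthonormal_expansion[OF us] v us_span by simp
    also have "R * X *\<^sub>v v = R *\<^sub>v (X *\<^sub>v v)"
      using carr Xc vcar by (intro assoc_mult_mat_vec) auto
    finally show ?thesis by simp
  qed

  define A11 where "A11 = R * A * Cu"
  define C11 where "C11 = R * C * Cu"
  have A11: "A11 \<in> carrier_mat k k" and C11: "C11 \<in> carrier_mat k k"
    using carr A C by (auto simp: A11_def C11_def)
  have RB: "R * B \<in> carrier_mat k m" using carr B by simp
  have "carrier_vec k \<subseteq> reach k A11 C11 (R * B) n"
  proof
    fix x :: "real vec" assume x: "x \<in> carrier_vec k"
    \<comment> \<open>\<open>x\<close> is the coordinate vector of \<open>Cu x\<close>, a vector of \<open>W\<close>.\<close>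
    have "Cu *\<^sub>v x \<in> reach n A C B n"
      using mat_of_cols_mult_in_span[OF uc, of x] x len_us us_span by (simp add: Cu_def W_def)
    then have "R *\<^sub>v (Cu *\<^sub>v x) \<in> reach k A11 C11 (R * B) n"
      using inter reach_W unfolding A11_def C11_def
      by (intro reach_intertwine[OF A C B A11 C11 carr(1), unfolded A11_def C11_def]) blast+
    moreover have "R *\<^sub>v (Cu *\<^sub>v x) = R * Cu *\<^sub>v x"
      using carr x by (intro assoc_mult_mat_vec[symmetric])
    moreover have "R * Cu = 1\<^sub>m k"
      unfolding R_def Cu_def using orthonormal_rows_cols[OF us] len_us by simp
    ultimately show "x \<in> reach k A11 C11 (R * B) n" using x by simp
  qed
  then have "reach k A11 C11 (R * B) n = carrier_vec k"
    using vec_subspaceD(1)[OF vec_subspace_reach[OF A11 C11 RB]] by blast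
  then have "subspace_dim k (word_span k (n - 1) A11 C11 (R * B)) = k"
    by (simp only: word_span_eq subspace_dim_carrier)
  moreover have "R * A * Cv \<in> carrier_mat k (n - k)" "R * C * Cv \<in> carrier_mat k (n - k)"
    "Q * A * Cv \<in> carrier_mat (n - k) (n - k)" "Q * C * Cv \<in> carrier_mat (n - k) (n - k)"
    using carr A C by auto
  ultimately show ?thesis
    using P P_orth A11 C11 RB block[of A] block[of C] B_block
    unfolding A11_def[symmetric] C11_def[symmetric] by blast
qed

end
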